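(* Let $N\ge 1$, let $\Omega\subset\mathbb{R}^N$ be a nonempty connected open set, let $p,q>1$, $\alpha,\beta>0$, and let $u,v$ be differentiable functions in $\Omega$ such that $u>0$, $v\ge 0$. If $q<p$, then, in $\Omega$, $$|\nabla u|^{p-2}\nabla u\nabla\left(\frac{v^p}{\alpha u^{p-1}+\beta u^{q-1}}\right)\le\frac{1}{\alpha C}|\nabla v|^p$$ and $$|\nabla u|^{q-2}\nabla u\nabla\left(\frac{v^p}{\alpha u^{p-1}+\beta u^{q-1}}\right)\le\frac{1}{\beta}|\nabla(v^{p/q})|^q,$$ where $C=1$ if $p\le q+1$, and $C=\frac{(q-1)^{p-2}(p-q)}{(p-2)^{p-2}}$ if $p\ge q+1$.
   Context: The product of two gradients denotes the Euclidean scalar product in $\mathbb{R}^N$, and $|\cdot|$ is the Euclidean norm. For $r>1$, $|\xi|^{r-2}\xi$ is understood as $0$ when $\xi=0$. *)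

theory Defs
  imports "HOL-Analysis.Analysis"
begin

text \<open>Unspecified at points where \<open>f\<close> is not differentiable.\<close>

definition gradient :: "('a::real_inner \<Rightarrow> real) \<Rightarrow> 'a \<Rightarrow> 'a" where
  "gradient f x = (THE D. GDERIV f x :> D)"

lemma gradient_eqI:
  assumes "GDERIV f x :> D"
  shows "gradient f x = D"
  unfolding gradient_def
proof (rule the_equality)
  fix E assume "GDERIV f x :> E"
  with assms have "(\<lambda>h. inner h E) = (\<lambda>h. inner h D)"
    unfolding gderiv_def by (rule has_derivative_unique[rotated])
  then have "inner (E - D) E = inner (E - D) D"
    by metis
  then have "inner (E - D) (E - D) = 0"
    by (simp add: inner_diff_right)
  then show "E = D" by simp
qed (fact assms)

lemma GDERIV_gradient:
  fixes f :: "'a::euclidean_space \<Rightarrow> real"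
  assumes "f differentiable (at x)"
  shows "GDERIV f x :> gradient f x"
proof -
  obtain f' where f': "(f has_derivative f') (at x)"
    using assms unfolding differentiable_def by blast
  interpret linear f'
    using f' by (rule has_derivative_linear)
  have "f' h = inner h (\<Sum>b\<in>Basis. f' b *\<^sub>R b)" for h
  proof -
    have "f' h = f' (\<Sum>b\<in>Basis. (h \<bullet> b) *\<^sub>R b)"
      by (simp add: euclidean_representation)
    also have "\<dots> = (\<Sum>b\<in>Basis. (h \<bullet> b) * f' b)"
      by (simp add: sum scale)
    also have "\<dots> = inner h (\<Sum>b\<in>Basis. f' b *\<^sub>R b)"
      by (simp add: inner_sum_right mult.commute)
    finally show ?thesis .
  qed
  then have "f' = (\<lambda>h. inner h (\<Sum>b\<in>Basis. f' b *\<^sub>R b))" by (rule ext)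
  with f' have "GDERIV f x :> (\<Sum>b\<in>Basis. f' b *\<^sub>R b)"
    unfolding gderiv_def by simp
  then show ?thesis
    using gradient_eqI by metis
qed

end

theory Submission
  imports Defs
begin

text \<open>Put \<open>\<phi>(t) = \<alpha> t\<^bsup>p-1\<^esup> + \<beta> t\<^bsup>q-1\<^esup>\<close>. Expanding \<open>\<nabla>(w\<^bsup>r\<^esup>/\<phi>(u))\<close> and using Cauchy-Schwarz bounds
  \<open>|\<nabla>u|\<^bsup>r-2\<^esup>\<nabla>u \<nabla>(w\<^bsup>r\<^esup>/\<phi>(u))\<close> by an expression in \<open>w|\<nabla>u|\<close> and \<open>|\<nabla>w|\<close>, which Young's inequality
  bounds by \<open>M|\<nabla>w|\<^bsup>r\<^esup>\<close> as soon as \<open>(r-1)\<^bsup>r-1\<^esup> \<phi>(u)\<^bsup>r-2\<^esup> \<le> M \<phi>'(u)\<^bsup>r-1\<^esup>\<close>. The first inequality is the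
  case \<open>r = p\<close>, \<open>w = v\<close>; the second is the case \<open>r = q\<close>, \<open>w = v\<^bsup>p/q\<^esup>\<close>, since \<open>v\<^bsup>p\<^esup> = w\<^bsup>q\<^esup>\<close>.\<close>

section \<open>Powers of nonnegative differentiable functions\<close>

text \<open>The one-sided derivative lets the base vanish: at 0 the difference quotient is
  \<open>s powr (r - 1)\<close>, which tends to 0 because \<open>r > 1\<close>.\<close>

lemma powr_has_real_derivative_within_nonneg:
  fixes r t :: real
  assumes "r > 1" and "t \<ge> 0"
  shows "((\<lambda>s. s powr r) has_real_derivative r * t powr (r - 1)) (at t within {0..})"
proof (cases "t = 0")
  case False
  with assms have "t > 0" by simp
  then show ?thesis
    by (rule has_field_derivative_at_within[OF has_real_derivative_powr])
next
  case True
  have "((\<lambda>s::real. s powr (r - 1)) \<longlongrightarrow> 0) (at 0 within {0..})"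
    using assms tendsto_powr'[of "\<lambda>s. s" 0 "at (0::real) within {0..}" "\<lambda>s. r - 1" "r - 1"]
    by (simp add: eventually_at_filter)
  then have "((\<lambda>s. (s powr r - 0 powr r) / (s - 0)) \<longlongrightarrow> 0) (at (0::real) within {0..})"
    by (rule Lim_transform_eventually) (auto simp: eventually_at_filter powr_diff)
  then show ?thesis
    using True by (simp add: has_field_derivative_iff)
qed

text \<open>As \<open>w\<close> maps \<open>S\<close> into the half-line, the one-sided derivative
  suffices for the chain rule within \<open>S\<close>; openness of \<open>S\<close> then removes the
  restriction.\<close>

lemma GDERIV_powr_nonneg:
  fixes w :: "'a::euclidean_space \<Rightarrow> real"
  assumes "open S" and "x \<in> S" and "r > 1"
    and "\<And>y. y \<in> S \<Longrightarrow> w y \<ge> 0"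
    and "GDERIV w x :> h"
  shows "GDERIV (\<lambda>y. w y powr r) x :> (r * w x powr (r - 1)) *\<^sub>R h"
proof -
  have "((\<lambda>s. s powr r) has_derivative (*) (r * w x powr (r - 1))) (at (w x) within w ` S)"
    using powr_has_real_derivative_within_nonneg[of r "w x"] assms
    by (auto simp: has_field_derivative_def intro!: has_derivative_subset[of _ _ _ "{0..}"])
  moreover have "(w has_derivative (\<lambda>y. inner y h)) (at x within S)"
    using assms(5) by (auto simp: gderiv_def intro: has_derivative_at_withinI)
  ultimately have "((\<lambda>y. w y powr r) has_derivative (\<lambda>y. r * w x powr (r - 1) * inner y h)) (at x within S)"
    by (rule has_derivative_in_compose[rotated])
  then show ?thesis
    by (simp add: gderiv_def at_within_open[OF assms(2,1)] mult.left_commute mult.assoc)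
qed

section \<open>Young-type inequalities\<close>

text \<open>Weighted AM-GM with weights \<open>1 / m\<close> and \<open>(m - 1) / m\<close>, raised
  to the power \<open>m\<close>.\<close>

lemma powr_AM_GM:
  fixes x y m :: real
  assumes "x \<ge> 0" and "y \<ge> 0" and "m \<ge> 1"
  shows "x * y powr (m - 1) \<le> ((x + (m - 1) * y) / m) powr m"
proof (cases "x = 0 \<or> y = 0")
  case True
  then show ?thesis by auto
next
  case False
  then have "x powr (1 / m) * y powr ((m - 1) / m) \<le> 1 / m * x + (m - 1) / m * y"
    using assms by (intro Youngs_inequality_0) (auto simp: field_simps)
  also have "\<dots> = (x + (m - 1) * y) / m"
    by (simp add: add_divide_distrib)
  finally have "(x powr (1 / m) * y powr ((m - 1) / m)) powr m \<le> ((x + (m - 1) * y) / m) powr m"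
    using assms by (intro powr_mono2) auto
  then show ?thesis
    using assms by (simp add: powr_mult powr_powr)
qed

lemma Young_powr:
  fixes s X r :: real
  assumes "s \<ge> 0" and "X \<ge> 0" and "r > 1"
  shows "r * s powr (r - 1) * X \<le> (r - 1) * s powr r + X powr r"
proof -
  have "X * s powr (r - 1) \<le> X powr r / r + (s powr (r - 1)) powr (r / (r - 1)) / (r / (r - 1))"
    using assms by (intro Youngs_inequality) (auto simp: field_simps)
  also have "\<dots> = (X powr r + (r - 1) * s powr r) / r"
    using assms by (simp add: powr_powr add_divide_distrib)
  finally show ?thesis
    using assms by (simp add: pos_le_divide_eq mult_ac)
qed

text \<open>Young's inequality is applied to \<open>\<mu> * t\<close> and \<open>H\<close>, with
  \<mu> chosen so that its \<open>t powr r\<close> term matches the subtracted one exactly. The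
  assumption on \<open>M\<close> absorbs the remaining factor
  \<open>\<mu> powr (r - 1)\<close>.\<close>

lemma Young_powr_scaled:
  fixes t H f d M r :: real
  assumes pos: "t \<ge> 0" "H \<ge> 0" "f > 0" "d > 0" "r > 1"
    and M: "1 \<le> M * f * (d / ((r - 1) * f)) powr (r - 1)"
  shows "r * t powr (r - 1) * H / f - t powr r * d / f\<^sup>2 \<le> M * H powr r"
proof -
  define \<mu> where "\<mu> = d / ((r - 1) * f)"
  define z where "z = \<mu> powr (r - 1)"
  have \<mu>: "\<mu> > 0" and z: "z > 0" using pos by (auto simp: \<mu>_def z_def)
  have zr: "\<mu> powr r = z * \<mu>" using \<mu> by (simp add: z_def powr_diff)
  have d: "d = (r - 1) * f * \<mu>" using pos by (simp add: \<mu>_def)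
  have "r * (\<mu> * t) powr (r - 1) * H \<le> (r - 1) * (\<mu> * t) powr r + H powr r"
    using pos \<mu> by (intro Young_powr) auto
  then have "z * (r * t powr (r - 1) * H - (r - 1) * \<mu> * t powr r) \<le> H powr r"
    using pos \<mu> by (simp add: powr_mult zr z_def[symmetric] algebra_simps)
  also have "\<dots> \<le> M * f * z * H powr r"
    using mult_right_mono[OF M, of "H powr r"] by (simp add: z_def \<mu>_def)
  finally have "z * (r * t powr (r - 1) * H - (r - 1) * \<mu> * t powr r) \<le> z * (M * f * H powr r)"
    by (simp add: mult_ac)
  then have "r * t powr (r - 1) * H - (r - 1) * \<mu> * t powr r \<le> M * f * H powr r"
    using z by simp
  then have "(r * t powr (r - 1) * H - (r - 1) * \<mu> * t powr r) / f \<le> M * H powr r"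
    using pos by (simp add: divide_le_eq mult_ac)
  moreover have "t powr r * d / f\<^sup>2 = (r - 1) * \<mu> * t powr r / f"
    using pos by (simp add: d power2_eq_square)
  ultimately show ?thesis
    by (simp add: diff_divide_distrib)
qed

section \<open>Picone-type gradient inequality\<close>

lemma Picone_inequality:
  fixes u w :: "'a::euclidean_space \<Rightarrow> real"
  assumes S: "open S" "x \<in> S" and r: "r > 1"
    and w: "\<And>y. y \<in> S \<Longrightarrow> w y \<ge> 0"
    and gu: "GDERIV u x :> g" and gw: "GDERIV w x :> h"
    and \<phi>: "(\<phi> has_real_derivative d) (at (u x))" and f: "\<phi> (u x) > 0" and d: "d > 0"
    and M: "1 \<le> M * \<phi> (u x) * (d / ((r - 1) * \<phi> (u x))) powr (r - 1)"
  shows "(norm g powr (r - 2) *\<^sub>R g) \<bullet> gradient (\<lambda>y. w y powr r / \<phi> (u y)) x \<le> M * norm h powr r"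
proof -
  let ?f = "\<phi> (u x)" and ?g = "norm g" and ?w = "w x"
  have w0: "?w \<ge> 0" using S w by simp
  have "GDERIV (\<lambda>y. \<phi> (u y)) x :> d *\<^sub>R g"
    using GDERIV_DERIV_compose[OF gu \<phi>] .
  then have "((\<lambda>y. \<phi> (u y)) has_derivative (\<lambda>k. k \<bullet> (d *\<^sub>R g))) (at x)"
    by (simp only: gderiv_def)
  from has_derivative_divide[OF GDERIV_powr_nonneg[OF S r w gw, unfolded gderiv_def] this]
  have "GDERIV (\<lambda>y. w y powr r / \<phi> (u y)) x :>
     (r * ?w powr (r - 1) / ?f) *\<^sub>R h - (?w powr r * d / ?f\<^sup>2) *\<^sub>R g"
    unfolding gderiv_def
    by (rule has_derivative_eq_rhs)
      (use f in \<open>auto simp: fun_eq_iff inner_diff_right power2_eq_square field_simps\<close>)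
  then have grad: "gradient (\<lambda>y. w y powr r / \<phi> (u y)) x =
     (r * ?w powr (r - 1) / ?f) *\<^sub>R h - (?w powr r * d / ?f\<^sup>2) *\<^sub>R g"
    by (rule gradient_eqI)
  \<comment> \<open>Since \<open>0 powr s = 0\<close> for every \<open>s\<close>, this also holds
    for \<open>g = 0\<close>, even when \<open>r < 2\<close>.\<close>
  have g1: "?g powr (r - 2) * ?g = ?g powr (r - 1)"
    using powr_mult_base[of ?g "r - 2"] by (simp add: mult.commute)
  have g2: "?g powr (r - 1) * ?g = ?g powr r"
    using powr_mult_base[of ?g "r - 1"] by (simp add: mult.commute)
  have "(?g powr (r - 2) *\<^sub>R g) \<bullet> gradient (\<lambda>y. w y powr r / \<phi> (u y)) x
      = r * ?w powr (r - 1) / ?f * ?g powr (r - 2) * (g \<bullet> h) - ?w powr r * d / ?f\<^sup>2 * (?g powr (r - 2) * ?g * ?g)"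
    unfolding grad
    by (simp add: inner_diff_right power2_norm_eq_inner[symmetric] power2_eq_square right_diff_distrib)
  also have "\<dots> \<le> r * ?w powr (r - 1) / ?f * ?g powr (r - 2) * (?g * norm h) - ?w powr r * d / ?f\<^sup>2 * (?g powr (r - 2) * ?g * ?g)"
    using r f by (intro diff_right_mono mult_left_mono norm_cauchy_schwarz) simp
  also have "r * ?w powr (r - 1) / ?f * ?g powr (r - 2) * (?g * norm h) = r * (?w * ?g) powr (r - 1) * norm h / ?f"
    using w0 by (simp add: g1[symmetric] powr_mult)
  also have "?w powr r * d / ?f\<^sup>2 * (?g powr (r - 2) * ?g * ?g) = (?w * ?g) powr r * d / ?f\<^sup>2"
    using w0 by (simp add: g1 g2 powr_mult)
  also have "r * (?w * ?g) powr (r - 1) * norm h / ?f - (?w * ?g) powr r * d / ?f\<^sup>2 \<le> M * norm h powr r"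
    using w0 by (intro Young_powr_scaled[OF _ _ f d r M]) simp_all
  finally show ?thesis .
qed

section \<open>Bounds for the constants\<close>

text \<open>With \<open>a = \<alpha> u\<^bsup>p-1\<^esup>\<close>, \<open>b = \<beta> u\<^bsup>q-1\<^esup>\<close> and \<open>\<phi>(t) = \<alpha> t\<^bsup>p-1\<^esup> + \<beta> t\<^bsup>q-1\<^esup>\<close>, the condition on \<open>M\<close> in
  \<open>Picone_inequality\<close> reads as the first bound below for \<open>r = p\<close>, \<open>M = 1/(\<alpha>C)\<close> and as the second for \<open>r = q\<close>,
  \<open>M = 1/\<beta>\<close>. The value of \<open>C\<close> for \<open>p \<ge> q + 1\<close> comes from weighted AM-GM applied to
  \<open>(p-1) a + (q-1) b = (p-q) a + (q-1) (a+b)\<close> with weights \<open>1/(p-1)\<close> and \<open>(p-2)/(p-1)\<close>.\<close>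

lemma constant_bound_first:
  fixes a b p q C :: real
  assumes pos: "a > 0" "b > 0" "p > 1" "q > 1" "q < p"
    and C1: "p \<le> q + 1 \<Longrightarrow> C = 1"
    and C2: "p \<ge> q + 1 \<Longrightarrow> C = ((q - 1) powr (p - 2) * (p - q)) / ((p - 2) powr (p - 2))"
  shows "C * a * (a + b) powr (p - 2) \<le> (((p - 1) * a + (q - 1) * b) / (p - 1)) powr (p - 1)"
    (is "_ \<le> ?e powr _")
proof -
  \<comment> \<open>For \<open>p \<le> 2\<close> the power \<open>p - 2\<close> is nonincreasing,
    and \<open>?e\<close> lies between \<open>a\<close> and \<open>a + b\<close>. For
    \<open>2 < p \<le> q + 1\<close>, AM-GM for \<open>a\<close> and \<open>a + b\<close> suffices
    because \<open>p - 2 \<le> q - 1\<close>.\<close>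
  consider "p \<le> 2" | "p > 2" "p \<le> q + 1" | "p \<ge> q + 1" using pos by linarith
  then show ?thesis
  proof cases
    case 1
    have e: "a \<le> ?e" "?e \<le> a + b" using pos by (auto simp: field_simps)
    have "a * (a + b) powr (p - 2) \<le> ?e * ?e powr (p - 2)"
      using pos e 1 by (intro mult_mono powr_mono2') auto
    also have "\<dots> = ?e powr (p - 1)"
      using pos e by (subst powr_mult_base) simp_all
    finally show ?thesis using C1 1 pos by simp
  next
    case 2
    have "a * (a + b) powr (p - 1 - 1) \<le> ((a + (p - 1 - 1) * (a + b)) / (p - 1)) powr (p - 1)"
      using pos 2 by (intro powr_AM_GM) auto
    also have "\<dots> \<le> ?e powr (p - 1)"
    proof (intro powr_mono2 divide_right_mono)
      have "(p - 2) * b \<le> (q - 1) * b" using 2 pos by (intro mult_right_mono) auto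
      then show "a + (p - 1 - 1) * (a + b) \<le> (p - 1) * a + (q - 1) * b"
        by (simp add: algebra_simps)
    qed (use pos 2 in auto)
    finally show ?thesis using C1 2 by (simp add: diff_diff_eq)
  next
    case 3
    \<comment> \<open>The factor in \<open>?y\<close> makes
      \<open>(p - 2) * ?y = (q - 1) * (a + b)\<close>; its power \<open>p - 2\<close>, times
      \<open>p - q\<close>, is \<open>C\<close>.\<close>
    let ?y = "(q - 1) / (p - 2) * (a + b)"
    have "((p - q) * a) * ?y powr (p - 1 - 1) \<le> (((p - q) * a + (p - 1 - 1) * ?y) / (p - 1)) powr (p - 1)"
      using pos 3 by (intro powr_AM_GM) auto
    moreover have "(p - q) * a + (p - 1 - 1) * ?y = (p - 1) * a + (q - 1) * b"
    proof -
      have "(p - 1 - 1) * ?y = (q - 1) * (a + b)"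
        using pos 3 by simp
      then show ?thesis by (simp add: algebra_simps)
    qed
    moreover have "((p - q) * a) * ?y powr (p - 1 - 1) = C * a * (a + b) powr (p - 2)"
      using pos 3 by (subst powr_mult) (simp_all add: powr_divide C2)
    ultimately show ?thesis by (simp only:)
  qed
qed

lemma constant_bound_second:
  fixes a b p q :: real
  assumes "a > 0" and "b > 0" and "p > 1" and "q > 1" and "q < p"
  shows "b * (a + b) powr (q - 2) \<le> (((p - 1) * a + (q - 1) * b) / (q - 1)) powr (q - 1)"
    (is "_ \<le> ?e powr _")
proof -
  have e: "b \<le> ?e" "a + b \<le> ?e" using assms by (auto simp: field_simps)
  show ?thesis
  \<comment> \<open>The sign of \<open>q - 2\<close> decides whether \<open>a + b\<close> is to be
    enlarged to \<open>?e\<close> or reduced to \<open>b\<close>.\<close>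
  proof (cases "q \<ge> 2")
    case True
    have "b * (a + b) powr (q - 2) \<le> ?e * ?e powr (q - 2)"
      using assms e True by (intro mult_mono powr_mono2) auto
    also have "\<dots> = ?e powr (q - 1)"
      using assms e by (subst powr_mult_base) simp_all
    finally show ?thesis .
  next
    case False
    have "b * (a + b) powr (q - 2) \<le> b * b powr (q - 2)"
      using assms False by (intro mult_left_mono powr_mono2') auto
    also have "\<dots> = b powr (q - 1)"
      using assms by (simp add: powr_mult_base)
    also have "\<dots> \<le> ?e powr (q - 1)"
      using assms e by (intro powr_mono2) auto
    finally show ?thesis .
  qed
qed

text \<open>The right-hand side is exactly the quotient of the two sides of \<open>le\<close>, with
  \<open>F\<close> for \<phi>(u) and \<open>e / t\<close> for its derivative.\<close>

lemma admissible_constant: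
  fixes t F e r c k :: real
  assumes "t > 0" and "F > 0" and "e > 0" and "r > 1" and "c > 0" and "k > 0"
    and le: "k * (c * t powr (r - 1)) * F powr (r - 2) \<le> (e / (r - 1)) powr (r - 1)"
  shows "1 \<le> 1 / (c * k) * F * ((e / t) / ((r - 1) * F)) powr (r - 1)"
proof -
  have "((e / t) / ((r - 1) * F)) powr (r - 1) = ((e / (r - 1)) / (F * t)) powr (r - 1)"
    by (simp add: field_simps)
  also have "\<dots> = (e / (r - 1)) powr (r - 1) / (F powr (r - 1) * t powr (r - 1))"
    using assms by (simp add: powr_divide powr_mult)
  also have "F powr (r - 1) = F * F powr (r - 2)"
    using assms by (simp add: powr_mult_base)
  finally have "1 / (c * k) * F * ((e / t) / ((r - 1) * F)) powr (r - 1)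
      = (e / (r - 1)) powr (r - 1) / (k * (c * t powr (r - 1)) * F powr (r - 2))"
    using assms(2) by (simp add: mult_ac)
  then show ?thesis
    using assms by simp
qed

section \<open>The two inequalities at a point\<close>

theorem proposition1p12:
  fixes \<Omega> :: "(real ^ 'n) set" and u v :: "real ^ 'n \<Rightarrow> real"
    and p q \<alpha> \<beta> C :: real
  assumes "open \<Omega>" and "connected \<Omega>" and "\<Omega> \<noteq> {}"
    and "p > 1" and "q > 1" and "\<alpha> > 0" and "\<beta> > 0"
    and "u differentiable_on \<Omega>" and "v differentiable_on \<Omega>"
    and "\<And>x. x \<in> \<Omega> \<Longrightarrow> u x > 0" and "\<And>x. x \<in> \<Omega> \<Longrightarrow> v x \<ge> 0"
    and "q < p"
    and "p \<le> q + 1 \<Longrightarrow> C = 1"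
    and "p \<ge> q + 1 \<Longrightarrow>
           C = ((q - 1) powr (p - 2) * (p - q)) / ((p - 2) powr (p - 2))"
  shows "\<forall>x\<in>\<Omega>.
     (norm (gradient u x) powr (p - 2) *\<^sub>R gradient u x) \<bullet>
       gradient (\<lambda>y. v y powr p / (\<alpha> * u y powr (p - 1) + \<beta> * u y powr (q - 1))) x
       \<le> 1 / (\<alpha> * C) * norm (gradient v x) powr p \<and>
     (norm (gradient u x) powr (q - 2) *\<^sub>R gradient u x) \<bullet>
       gradient (\<lambda>y. v y powr p / (\<alpha> * u y powr (p - 1) + \<beta> * u y powr (q - 1))) x
       \<le> 1 / \<beta> * norm (gradient (\<lambda>y. v y powr (p / q)) x) powr q"
proof
  fix x assume x: "x \<in> \<Omega>"
  define \<phi> where "\<phi> = (\<lambda>t. \<alpha> * t powr (p - 1) + \<beta> * t powr (q - 1))"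
  define a b where "a = \<alpha> * u x powr (p - 1)" and "b = \<beta> * u x powr (q - 1)"
  define e where "e = (p - 1) * a + (q - 1) * b"
  have ux: "u x > 0" using assms(10) x by simp
  then have ab: "a > 0" "b > 0" using assms(6,7) by (simp_all add: a_def b_def)
  then have e: "e > 0" using assms(4,5) by (simp add: e_def add_pos_pos)
  have "u differentiable (at x)" "v differentiable (at x)"
    using assms(1,8,9) x by (metis at_within_open differentiable_on_def)+
  then have gu: "GDERIV u x :> gradient u x" and gv: "GDERIV v x :> gradient v x"
    by (auto intro: GDERIV_gradient)
  \<comment> \<open>Here \<open>p / q > 1\<close>, so the power of \<open>v\<close> is
    differentiable even at zeros of \<open>v\<close>.\<close>
  have gw: "GDERIV (\<lambda>y. v y powr (p / q)) x :> gradient (\<lambda>y. v y powr (p / q)) x"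
    using GDERIV_powr_nonneg[OF assms(1) x _ assms(11) gv, of "p / q"] assms(5,12) gradient_eqI by fastforce
  have \<phi>': "(\<phi> has_real_derivative e / u x) (at (u x))"
  proof -
    have "(\<phi> has_real_derivative \<alpha> * ((p - 1) * u x powr (p - 1 - 1))
        + \<beta> * ((q - 1) * u x powr (q - 1 - 1))) (at (u x))"
      unfolding \<phi>_def by (intro DERIV_add DERIV_cmult has_real_derivative_powr ux)
    also have "\<alpha> * ((p - 1) * u x powr (p - 1 - 1)) + \<beta> * ((q - 1) * u x powr (q - 1 - 1)) = e / u x"
      unfolding powr_diff[of "u x" _ 1] using ux
      by (simp add: e_def a_def b_def add_divide_distrib powr_diff mult.left_commute)
    finally show ?thesis .
  qed
  have \<phi>x: "\<phi> (u x) = a + b" by (simp add: \<phi>_def a_def b_def)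
  have C: "C > 0"
    using assms(5,12-14) by (cases "p \<le> q + 1") auto
  have Mp: "1 \<le> 1 / (\<alpha> * C) * \<phi> (u x) * ((e / u x) / ((p - 1) * \<phi> (u x))) powr (p - 1)"
    unfolding \<phi>x using constant_bound_first[OF ab assms(4,5,12-14)] assms(4,6) ux ab e C
    by (intro admissible_constant) (simp_all add: a_def e_def add_pos_pos)
  have Mq: "1 \<le> 1 / (\<beta> * 1) * \<phi> (u x) * ((e / u x) / ((q - 1) * \<phi> (u x))) powr (q - 1)"
    unfolding \<phi>x using constant_bound_second[OF ab assms(4,5,12)] assms(5,7) ux ab e
    by (intro admissible_constant) (simp_all add: b_def e_def add_pos_pos)
  have pos: "\<phi> (u x) > 0" "e / u x > 0" using ab e ux \<phi>x by auto
  have 1: "(norm (gradient u x) powr (p - 2) *\<^sub>R gradient u x) \<bullet>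
       gradient (\<lambda>y. v y powr p / \<phi> (u y)) x \<le> 1 / (\<alpha> * C) * norm (gradient v x) powr p"
    using assms(4,11) by (intro Picone_inequality[OF assms(1) x _ _ gu gv \<phi>' pos Mp]) auto
  have "(norm (gradient u x) powr (q - 2) *\<^sub>R gradient u x) \<bullet>
       gradient (\<lambda>y. (v y powr (p / q)) powr q / \<phi> (u y)) x
       \<le> 1 / (\<beta> * 1) * norm (gradient (\<lambda>y. v y powr (p / q)) x) powr q"
    using assms(5) by (intro Picone_inequality[OF assms(1) x _ _ gu gw \<phi>' pos Mq]) auto
  then have 2: "(norm (gradient u x) powr (q - 2) *\<^sub>R gradient u x) \<bullet>
       gradient (\<lambda>y. v y powr p / \<phi> (u y)) x
       \<le> 1 / \<beta> * norm (gradient (\<lambda>y. v y powr (p / q)) x) powr q"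
    using assms(5) by (simp add: powr_powr)
  from 1 2 show "(norm (gradient u x) powr (p - 2) *\<^sub>R gradient u x) \<bullet>
       gradient (\<lambda>y. v y powr p / (\<alpha> * u y powr (p - 1) + \<beta> * u y powr (q - 1))) x
       \<le> 1 / (\<alpha> * C) * norm (gradient v x) powr p \<and>
     (norm (gradient u x) powr (q - 2) *\<^sub>R gradient u x) \<bullet>
       gradient (\<lambda>y. v y powr p / (\<alpha> * u y powr (p - 1) + \<beta> * u y powr (q - 1))) x
       \<le> 1 / \<beta> * norm (gradient (\<lambda>y. v y powr (p / q)) x) powr q"
    by (simp add: \<phi>_def)
qed

end
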